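(* There exist a hereditarily Volterra space $X$ and a hereditarily Baire space $Y$ such that the product space $X \times Y$ is not weakly Volterra.
   Context: A subset of a topological space is a $G_\delta$ set if it is a countable intersection of open sets. A space is Volterra (respectively, weakly Volterra) if for every pair $G, H$ of dense $G_\delta$ subsets, the set $G \cap H$ is dense (respectively, non-empty). A space is Baire if every countable intersection of dense open subsets is dense. A space is hereditarily Volterra (respectively, hereditarily Baire) if every one of its subspaces (not only the closed ones) is Volterra (respectively, Baire). The product carries the usual product topology. The spaces $X$ and $Y$ are understood to be non-empty. *)

theory Defs
  imports "HOL-Analysis.Analysis"
begin

definition dense_in :: "'a topology \<Rightarrow> 'a set \<Rightarrow> bool" where
  "dense_in X S \<longleftrightarrow> S \<subseteq> topspace X \<and> X closure_of S = topspace X"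

definition Volterra_space :: "'a topology \<Rightarrow> bool" where
  "Volterra_space X \<longleftrightarrow>
     (\<forall>G H. gdelta_in X G \<and> dense_in X G \<and> gdelta_in X H \<and> dense_in X H
            \<longrightarrow> dense_in X (G \<inter> H))"

definition weakly_Volterra_space :: "'a topology \<Rightarrow> bool" where
  "weakly_Volterra_space X \<longleftrightarrow>
     (\<forall>G H. gdelta_in X G \<and> dense_in X G \<and> gdelta_in X H \<and> dense_in X H
            \<longrightarrow> G \<inter> H \<noteq> {})"

text \<open>Intersecting with \<^term>\<open>topspace X\<close> makes the intersection of the empty family
  the whole space rather than \<^term>\<open>UNIV\<close>.\<close>

definition Baire_space :: "'a topology \<Rightarrow> bool" where
  "Baire_space X \<longleftrightarrow>
     (\<forall>\<U>. countable \<U> \<and> (\<forall>U\<in>\<U>. openin X U \<and> dense_in X U)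
            \<longrightarrow> dense_in X (topspace X \<inter> \<Inter>\<U>))"

end

theory Submission
  imports Defs
begin

text \<open>
  For \<open>X\<close> take a topology whose nonempty open sets are the members of a free ultrafilter \<open>F\<close>
  concentrated on the natural numbers. If \<open>G\<close> is dense in a subspace \<open>S\<close>, then \<open>S - G\<close> cannot
  belong to \<open>F\<close>, so its complement does, and \<open>G\<close>, the trace of that complement on \<open>S\<close>, is open
  in \<open>S\<close>. Two dense sets of a subspace are thus dense open, and so is their intersection.

  For \<open>Y\<close> take the real line with the sets \<open>U - M\<close> as open sets, where \<open>U\<close> is Euclidean open
  and \<open>M\<close> is meagre. A dense open subset of a subspace \<open>E\<close> misses only a meagre part of \<open>E\<close>
  (\<open>meagre_Diff_dense_open\<close>), so a countable intersection \<open>D\<close> of such sets does too. Let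
  \<open>E \<inter> (V - M)\<close> be a nonempty open set of \<open>E\<close>. If \<open>E \<inter> V\<close> is not meagre, then
  \<open>E - D\<close> and \<open>M\<close> together cannot cover it; if it is meagre, all its points are isolated
  in \<open>E\<close> and lie in every dense set. In either case \<open>D\<close> meets \<open>E \<inter> (V - M)\<close>.

  In the product consider the pairs \<open>(n, y)\<close> with \<open>n\<close> natural and \<open>sin (n y) > 0\<close>, and those with
  \<open>sin (n y) < 0\<close>. The two sets are disjoint. They are \<open>G\<^sub>\<delta>\<close> because the countably many
  points of \<open>\<nat>\<close> are closed in \<open>X\<close> and each vertical section is open. They are dense
  because the oscillation speeds up: an open box \<open>A \<times> (W - M)\<close> has arbitrarily large
  \<open>n\<close> in \<open>A\<close>, and for large \<open>n\<close> both signs occur on Euclidean open subsets of \<open>W\<close>,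
  which \<open>M\<close> cannot exhaust by the Baire category theorem.
\<close>

section \<open>Free ultrafilters\<close>

definition ultra :: "'a filter \<Rightarrow> bool" where
  "ultra F \<longleftrightarrow> F \<noteq> bot \<and> (\<forall>P. eventually P F \<or> eventually (\<lambda>x. \<not> P x) F)"

text \<open>Finer filters are smaller in the order, so Zorn's lemma is applied to the reverse order;
  the infimum of a chain of proper filters is proper because each of its events is already an
  event of a single member of the chain.\<close>

lemma ultra_exists:
  fixes F0 :: "'a filter"
  assumes "F0 \<noteq> bot"
  obtains F where "F \<le> F0" "ultra F"
proof -
  let ?A = "{F. F \<noteq> bot \<and> F \<le> F0}"
  have po: "partial_order_on ?A (relation_of (\<lambda>F G. G \<le> F) ?A)"
    by (rule partial_order_on_relation_ofI) auto
  have "\<exists>m\<in>?A. \<forall>a\<in>?A. a \<le> m \<longrightarrow> a = m"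
  proof (rule predicate_Zorn[OF po])
    fix C assume C: "C \<in> Chains (relation_of (\<lambda>F G. G \<le> F) ?A)"
    then have CA: "C \<subseteq> ?A" and tot: "\<And>F G. F \<in> C \<Longrightarrow> G \<in> C \<Longrightarrow> F \<le> G \<or> G \<le> F"
      by (auto simp: Chains_def relation_of_def)
    show "\<exists>u\<in>?A. \<forall>a\<in>C. u \<le> a"
    proof (cases "C = {}")
      case True
      then show ?thesis using assms by blast
    next
      case False
      have "eventually P (Inf C) \<longleftrightarrow> (\<exists>b\<in>C. eventually P b)" for P
      proof (rule eventually_Inf_base[OF False])
        fix F G assume FG: "F \<in> C" "G \<in> C"
        show "\<exists>x\<in>C. x \<le> inf F G"
          using tot[OF FG] FG by auto
      qed
      then have "Inf C \<noteq> bot"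
        using CA unfolding trivial_limit_def by blast
      moreover have "Inf C \<le> F0"
      proof -
        obtain G where "G \<in> C" "G \<le> F0"
          using False CA by blast
        then show ?thesis
          by (rule Inf_lower2)
      qed
      ultimately show ?thesis
        by (intro bexI[of _ "Inf C"]) (auto intro: Inf_lower)
    qed
  qed
  then obtain F where F: "F \<noteq> bot" "F \<le> F0"
    and max: "\<And>G. G \<noteq> bot \<Longrightarrow> G \<le> F \<Longrightarrow> G = F"
    by (metis (mono_tags, lifting) mem_Collect_eq order_trans)
  have "eventually P F \<or> eventually (\<lambda>x. \<not> P x) F" for P
  proof (cases "inf F (principal {x. P x}) = bot")
    case True
    then show ?thesis
      by (simp add: trivial_limit_def eventually_inf_principal)
  next
    case False
    then have "inf F (principal {x. P x}) = F"
      by (rule max) simp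
    moreover have "eventually P (inf F (principal {x. P x}))"
      by (simp add: eventually_inf_principal)
    ultimately show ?thesis by simp
  qed
  then have "ultra F"
    using F(1) by (simp add: ultra_def)
  with F(2) show thesis
    by (rule that)
qed

section \<open>The topology of an ultrafilter\<close>

definition filter_topology :: "'a filter \<Rightarrow> 'a topology" where
  "filter_topology F = topology (\<lambda>S. S = {} \<or> eventually (\<lambda>x. x \<in> S) F)"

lemma openin_filter_topology:
  "openin (filter_topology F) S \<longleftrightarrow> S = {} \<or> eventually (\<lambda>x. x \<in> S) F"
proof -
  have "istopology (\<lambda>S. S = {} \<or> eventually (\<lambda>x. x \<in> S) F)"
    unfolding istopology_def
  proof (intro conjI allI impI)
    fix S T assume "S = {} \<or> eventually (\<lambda>x. x \<in> S) F" "T = {} \<or> eventually (\<lambda>x. x \<in> T) F"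
    then show "S \<inter> T = {} \<or> eventually (\<lambda>x. x \<in> S \<inter> T) F"
      by (auto intro: eventually_conj)
  next
    fix \<K> assume "\<forall>K\<in>\<K>. K = {} \<or> eventually (\<lambda>x. x \<in> K) F"
    then show "\<Union>\<K> = {} \<or> eventually (\<lambda>x. x \<in> \<Union>\<K>) F"
      by (metis (mono_tags, lifting) Sup_bot_conv(1) UnionI eventually_mono)
  qed
  then show ?thesis
    by (simp add: filter_topology_def)
qed

lemma topspace_filter_topology [simp]: "topspace (filter_topology F) = UNIV"
proof -
  have "openin (filter_topology F) UNIV"
    by (simp add: openin_filter_topology)
  then show ?thesis
    using openin_subset by blast
qed

lemma dense_in_iff:
  "dense_in X S \<longleftrightarrow> S \<subseteq> topspace X \<and> (\<forall>T. openin X T \<and> T \<noteq> {} \<longrightarrow> S \<inter> T \<noteq> {})"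
  by (simp add: dense_in_def dense_intersects_open)

text \<open>Spaces with this property are called submaximal; here it is inherited by all subspaces.\<close>

lemma dense_in_subspace_ultra_open:
  assumes "ultra F" and G: "dense_in (subtopology (filter_topology F) S) G"
  shows "openin (subtopology (filter_topology F) S) G"
proof -
  have GS: "G \<subseteq> S"
    using G by (simp add: dense_in_def)
  have "\<not> eventually (\<lambda>x. x \<in> S - G) F"
  proof
    assume ev: "eventually (\<lambda>x. x \<in> S - G) F"
    then have "openin (filter_topology F) (S - G)"
      by (simp add: openin_filter_topology)
    moreover have "S - G = (S - G) \<inter> S"
      by blast
    ultimately have "openin (subtopology (filter_topology F) S) (S - G)"
      unfolding openin_subtopology by blast
    moreover have "S - G \<noteq> {}"
    proof
      assume "S - G = {}"
      then have "eventually (\<lambda>x. False) F"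
        using ev by (simp only: empty_iff)
      then show False
        using \<open>ultra F\<close> by (simp add: ultra_def trivial_limit_def)
    qed
    ultimately show False
      using G unfolding dense_in_iff by blast
  qed
  moreover have "eventually (\<lambda>x. x \<in> S - G) F \<or> eventually (\<lambda>x. x \<notin> S - G) F"
    using \<open>ultra F\<close> unfolding ultra_def by (elim conjE allE)
  ultimately have "eventually (\<lambda>x. x \<in> - (S - G)) F"
    by (simp only: Compl_iff simp_thms)
  then have "openin (filter_topology F) (- (S - G))"
    by (simp add: openin_filter_topology)
  moreover have "G = - (S - G) \<inter> S"
    using GS by auto
  ultimately show ?thesis
    using openin_subtopology_Int by metis
qed

lemma hereditarily_Volterra_ultra:
  assumes "ultra F"
  shows "hereditarily Volterra_space (filter_topology F)"
  unfolding hereditarily_def Volterra_space_def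
proof (intro allI impI)
  fix S G H
  let ?T = "subtopology (filter_topology F) S"
  assume GH: "gdelta_in ?T G \<and> dense_in ?T G \<and> gdelta_in ?T H \<and> dense_in ?T H"
  have "openin ?T H"
    using assms GH dense_in_subspace_ultra_open by blast
  show "dense_in ?T (G \<inter> H)"
    unfolding dense_in_iff
  proof (intro conjI allI impI)
    show "G \<inter> H \<subseteq> topspace ?T"
      using GH unfolding dense_in_iff by blast
    fix T assume T: "openin ?T T \<and> T \<noteq> {}"
    then have "openin ?T (H \<inter> T)" "H \<inter> T \<noteq> {}"
      using GH \<open>openin ?T H\<close> unfolding dense_in_iff by blast+
    then show "G \<inter> H \<inter> T \<noteq> {}"
      using GH unfolding dense_in_iff by (metis Int_assoc)
  qed
qed

section \<open>Open sets modulo meagre sets\<close>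

definition meagre :: "'a::topological_space set \<Rightarrow> bool" where
  "meagre S \<longleftrightarrow> (\<exists>\<F>. countable \<F> \<and> (\<forall>A\<in>\<F>. closed A \<and> interior A = {}) \<and> S \<subseteq> \<Union>\<F>)"

lemma meagre_subset: "meagre T \<Longrightarrow> S \<subseteq> T \<Longrightarrow> meagre S"
  unfolding meagre_def by (meson order_trans)

lemma meagre_empty [simp]: "meagre {}"
  unfolding meagre_def by (intro exI[of _ "{}"]) auto

lemma meagre_Union:
  assumes "countable \<M>" "\<And>M. M \<in> \<M> \<Longrightarrow> meagre M"
  shows "meagre (\<Union>\<M>)"
proof -
  obtain f where f: "\<And>M. M \<in> \<M> \<Longrightarrow> countable (f M) \<and>
      (\<forall>A\<in>f M. closed A \<and> interior A = {}) \<and> M \<subseteq> \<Union>(f M)"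
    using assms(2) unfolding meagre_def by metis
  show ?thesis
    unfolding meagre_def
  proof (intro exI[of _ "\<Union>(f ` \<M>)"] conjI)
    show "countable (\<Union>(f ` \<M>))"
      using f assms(1) by auto
    show "\<forall>A\<in>\<Union>(f ` \<M>). closed A \<and> interior A = {}"
      using f by blast
    show "\<Union>\<M> \<subseteq> \<Union>(\<Union>(f ` \<M>))"
    proof
      fix x assume "x \<in> \<Union>\<M>"
      then obtain M where M: "M \<in> \<M>" "x \<in> M"
        by blast
      then have "x \<in> \<Union>(f M)"
        using f[OF M(1)] by blast
      then show "x \<in> \<Union>(\<Union>(f ` \<M>))"
        using M(1) by blast
    qed
  qed
qed

lemma meagre_Un: "meagre S \<Longrightarrow> meagre T \<Longrightarrow> meagre (S \<union> T)"
  using meagre_Union[of "{S, T}"] by auto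

lemma meagre_nowhere_dense: "interior (closure S) = {} \<Longrightarrow> meagre S"
  unfolding meagre_def by (intro exI[of _ "{closure S}"]) (use closure_subset[of S] in auto)

lemma open_not_meagre:
  fixes U :: "'a::{real_normed_vector, heine_borel} set"
  assumes "open U" "meagre U"
  shows "U = {}"
proof -
  obtain \<F> where \<F>: "countable \<F>" "\<And>A. A \<in> \<F> \<Longrightarrow> closed A \<and> interior A = {}" "U \<subseteq> \<Union>\<F>"
    using assms(2) unfolding meagre_def by blast
  have "UNIV \<subseteq> closure (\<Inter>(uminus ` \<F>))"
    by (rule Baire) (use \<F> in \<open>auto simp: closure_complement\<close>)
  moreover have "U \<inter> \<Inter>(uminus ` \<F>) = {}"
    using \<F>(3) by auto
  ultimately show ?thesis
    using open_Int_closure_eq_empty[OF \<open>open U\<close>] by auto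
qed

definition meagre_topology :: "'a::second_countable_topology topology" where
  "meagre_topology = topology (\<lambda>S. \<exists>U M. open U \<and> meagre M \<and> S = U - M)"

text \<open>Second countability enters here: a union of sets \<open>U - M\<close> covers the union of the \<open>U\<close>
  up to the meagre parts of a countable subfamily.\<close>

lemma openin_meagre_topology:
  "openin meagre_topology S \<longleftrightarrow> (\<exists>U M. open U \<and> meagre M \<and> S = U - M)"
proof -
  have "istopology (\<lambda>S::'a set. \<exists>U M. open U \<and> meagre M \<and> S = U - M)"
    unfolding istopology_def
  proof (intro conjI allI impI)
    fix S T :: "'a set"
    assume "\<exists>U M. open U \<and> meagre M \<and> S = U - M" "\<exists>U M. open U \<and> meagre M \<and> T = U - M"
    then obtain U M V N where "open U" "meagre M" "S = U - M" "open V" "meagre N" "T = V - N"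
      by blast
    then show "\<exists>U M. open U \<and> meagre M \<and> S \<inter> T = U - M"
      by (intro exI[of _ "U \<inter> V"] exI[of _ "M \<union> N"]) (auto intro: meagre_Un)
  next
    fix \<K> :: "'a set set"
    assume "\<forall>K\<in>\<K>. \<exists>U M. open U \<and> meagre M \<and> K = U - M"
    then obtain u m where um: "\<And>K. K \<in> \<K> \<Longrightarrow> open (u K) \<and> meagre (m K) \<and> K = u K - m K"
      by metis
    obtain \<F> where \<F>: "\<F> \<subseteq> u ` \<K>" "countable \<F>" "\<Union>\<F> = \<Union>(u ` \<K>)"
      by (rule Lindelof[of "u ` \<K>"]) (use um in auto)
    obtain \<C> where \<C>: "\<C> \<subseteq> \<K>" "countable \<C>" "\<F> = u ` \<C>"
      using \<F>(1,2) by (meson countable_subset_image)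
    let ?U = "\<Union>(u ` \<K>)"
    have "?U - \<Union>\<K> \<subseteq> \<Union>(m ` \<C>)"
    proof
      fix x assume x: "x \<in> ?U - \<Union>\<K>"
      then obtain K where "K \<in> \<C>" "x \<in> u K"
        using \<F>(3) \<C>(3) by blast
      then show "x \<in> \<Union>(m ` \<C>)"
        using x um[of K] \<C>(1) by blast
    qed
    moreover have "meagre (\<Union>(m ` \<C>))"
      by (rule meagre_Union) (use \<C> um in auto)
    ultimately have "meagre (?U - \<Union>\<K>)"
      using meagre_subset by blast
    moreover have "open ?U"
      using um by blast
    moreover have "\<Union>\<K> = ?U - (?U - \<Union>\<K>)"
      using um by blast
    ultimately show "\<exists>U M. open U \<and> meagre M \<and> \<Union>\<K> = U - M"
      by blast
  qed
  then show ?thesis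
    by (simp add: meagre_topology_def)
qed

lemma openin_meagre_topology_Diff: "open U \<Longrightarrow> meagre M \<Longrightarrow> openin meagre_topology (U - M)"
  unfolding openin_meagre_topology by (intro exI[of _ U] exI[of _ M]) simp

lemma openin_meagre_topology_open: "open U \<Longrightarrow> openin meagre_topology U"
  using openin_meagre_topology_Diff[of U "{}"] by simp

lemma topspace_meagre_topology [simp]: "topspace meagre_topology = UNIV"
  using openin_subset[OF openin_meagre_topology_open[OF open_UNIV]] by blast

text \<open>Writing the dense open set as \<open>E \<inter> (W - M)\<close>, even \<open>E - W\<close> is nowhere dense in the
  original topology: if it were dense in an open set \<open>O\<close>, it would have a point in \<open>O\<close>, so
  density would provide a point of \<open>W \<inter> O\<close>; but then \<open>W \<inter> O\<close> is a nonempty open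
  set that misses \<open>E - W\<close>.\<close>

lemma meagre_Diff_dense_open:
  assumes "openin (subtopology meagre_topology E) D"
    and "dense_in (subtopology meagre_topology E) D"
  shows "meagre (E - D)"
proof -
  obtain W M where W: "open W" "meagre M" "D = (W - M) \<inter> E"
    using assms(1) unfolding openin_subtopology openin_meagre_topology by blast
  let ?O = "interior (closure (E - W))"
  have "?O = {}"
  proof (rule ccontr)
    assume ne: "?O \<noteq> {}"
    have sub: "?O \<subseteq> closure (E - W)"
      by (rule interior_subset)
    have "?O \<inter> (E - W) \<noteq> {}"
      using open_Int_closure_eq_empty[OF open_interior] ne sub by blast
    then have "?O \<inter> E \<noteq> {}"
      by blast
    moreover have "openin (subtopology meagre_topology E) (?O \<inter> E)"
      by (intro openin_subtopology_Int openin_meagre_topology_open open_interior)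
    ultimately have "D \<inter> (?O \<inter> E) \<noteq> {}"
      using assms(2) unfolding dense_in_iff by blast
    then have "W \<inter> ?O \<noteq> {}"
      using W(3) by blast
    moreover have "W \<inter> ?O \<inter> (E - W) = {}"
      by blast
    then have "W \<inter> ?O \<inter> closure (E - W) = {}"
      using open_Int_closure_eq_empty[of "W \<inter> ?O"] W(1) by blast
    ultimately show False
      using sub by blast
  qed
  then have "meagre (E - W)"
    by (rule meagre_nowhere_dense)
  then have "meagre ((E - W) \<union> M)"
    using W(2) meagre_Un by blast
  then show ?thesis
    by (rule meagre_subset) (use W(3) in blast)
qed

lemma hereditarily_Baire_meagre_topology:
  "hereditarily Baire_space (meagre_topology :: 'a::{second_countable_topology, t1_space} topology)"
  unfolding hereditarily_def Baire_space_def
proof (intro allI impI)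
  fix E :: "'a set" and \<U>
  let ?T = "subtopology meagre_topology E"
  assume \<U>: "countable \<U> \<and> (\<forall>U\<in>\<U>. openin ?T U \<and> dense_in ?T U)"
  show "dense_in ?T (topspace ?T \<inter> \<Inter>\<U>)"
    unfolding dense_in_iff
  proof (intro conjI allI impI)
    show "topspace ?T \<inter> \<Inter>\<U> \<subseteq> topspace ?T"
      by blast
    fix T assume T: "openin ?T T \<and> T \<noteq> {}"
    then obtain V M where V: "open V" "meagre M" "T = (V - M) \<inter> E"
      unfolding openin_subtopology openin_meagre_topology by blast
    obtain e where e: "e \<in> T"
      using T by blast
    show "topspace ?T \<inter> \<Inter>\<U> \<inter> T \<noteq> {}"
    proof (cases "meagre (E \<inter> V)")
      case True
      \<comment> \<open>All of \<open>E \<inter> V\<close> except \<open>e\<close> may be removed from \<open>V\<close>, which isolates \<open>e\<close> in \<open>E\<close>.\<close>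
      have "openin meagre_topology (V - (E \<inter> V - {e}))"
        by (rule openin_meagre_topology_Diff[OF V(1)]) (rule meagre_subset[OF True], blast)
      moreover have "{e} = (V - (E \<inter> V - {e})) \<inter> E"
        using e V(3) by blast
      ultimately have "openin ?T {e}"
        using openin_subtopology_Int by metis
      then have "e \<in> U" if "U \<in> \<U>" for U
        using \<U> that unfolding dense_in_iff by blast
      then show ?thesis
        using e V(3) by auto
    next
      case False
      have "meagre (\<Union>((\<lambda>U. E - U) ` \<U>))"
        by (rule meagre_Union) (use \<U> in \<open>auto intro: meagre_Diff_dense_open\<close>)
      then have "meagre (\<Union>((\<lambda>U. E - U) ` \<U>) \<union> M)"
        using V(2) meagre_Un by blast
      then have "\<not> E \<inter> V \<subseteq> \<Union>((\<lambda>U. E - U) ` \<U>) \<union> M"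
        using False meagre_subset by blast
      then show ?thesis
        using V(3) by auto
    qed
  qed
qed

section \<open>Two disjoint dense sets in the product\<close>

definition sine_set :: "real \<Rightarrow> (real \<times> real) set" where
  "sine_set s = {(x, y). x \<in> \<nat> \<and> 0 < s * sin (x * y)}"

text \<open>Every point \<open>n\<close> is closed in the ultrafilter topology, so prescribing the section over \<open>n\<close> alone to be a given
  open set is an open condition; countably many of them, one for each natural number, define the
  set inside the open strip over \<open>\<nat>\<close>.\<close>

lemma gdelta_in_sine_set:
  assumes Nats: "eventually (\<lambda>x. x \<in> \<nat>) F" and free: "\<And>n. eventually (\<lambda>x. x \<noteq> n) F"
  shows "gdelta_in (prod_topology (filter_topology F) meagre_topology) (sine_set s)"
proof -
  let ?P = "prod_topology (filter_topology F) (meagre_topology :: real topology)"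
  define R where "R n = ((- {n}) \<times> UNIV) \<union> (UNIV \<times> {y. 0 < s * sin (n * y)})" for n
  have "openin ?P (R n)" for n
  proof -
    have "openin (filter_topology F) (- {n})"
      using free by (simp add: openin_filter_topology)
    moreover have "openin meagre_topology {y. 0 < s * sin (n * y)}"
      by (intro openin_meagre_topology_open open_Collect_less continuous_intros)
    moreover have "openin (filter_topology F) UNIV" "openin meagre_topology (UNIV :: real set)"
      using openin_topspace[of "filter_topology F"] openin_topspace[of "meagre_topology :: real topology"]
      by simp_all
    ultimately show ?thesis
      unfolding R_def by (intro openin_Un) (simp_all only: openin_prod_Times_iff simp_thms)
  qed
  then have "gdelta_in ?P (\<Inter>(R ` \<nat>))"
    by (intro gdelta_in_Inter) (auto intro: open_imp_gdelta_in countable_image simp: Nats_def)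
  moreover have "openin ?P (\<nat> \<times> UNIV)"
    using openin_topspace[of "meagre_topology :: real topology"] Nats
    by (simp add: openin_prod_Times_iff openin_filter_topology)
  then have "gdelta_in ?P (\<nat> \<times> UNIV)"
    by (rule open_imp_gdelta_in)
  moreover have "sine_set s = (\<nat> \<times> UNIV) \<inter> \<Inter>(R ` \<nat>)"
    by (auto simp: sine_set_def R_def)
  ultimately show ?thesis
    by (simp add: gdelta_in_Int)
qed

text \<open>The witness is the point \<open>(2 \<pi> k + s \<pi> / 2) / n\<close>, where the sine attains the value \<open>s\<close>; \<open>k\<close> is
  chosen so that it lies within \<open>(2 \<pi> + \<pi> / 2) / n\<close> of \<open>y\<close>.\<close>

lemma sine_sign_near:
  fixes y n e s :: real
  assumes s: "s = 1 \<or> s = -1" and n: "0 < n" "3 * pi < n * e"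
  obtains z where "dist z y < e" "0 < s * sin (n * z)"
proof -
  define k where "k = \<lceil>n * y / (2 * pi)\<rceil>"
  define z where "z = (2 * pi * of_int k + s * pi / 2) / n"
  have "n * y / (2 * pi) \<le> k" "k < n * y / (2 * pi) + 1"
    unfolding k_def by linarith+
  then have k: "n * y \<le> 2 * pi * k" "2 * pi * k < n * y + 2 * pi"
    by (simp_all add: field_simps)
  have nz: "n * z = s * pi / 2 + of_int k * (2 * pi)"
    using n by (simp add: z_def)
  have "n * dist z y = \<bar>n * z - n * y\<bar>"
    using n by (simp add: dist_real_def abs_mult flip: right_diff_distrib)
  also have "\<dots> < 3 * pi"
    using k s pi_gt_zero unfolding nz by (auto simp: abs_less_iff algebra_simps)
  also note n(2)
  finally have "n * dist z y < n * e" .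
  then have "dist z y < e"
    by (rule mult_left_less_imp_less) (use n in simp)
  moreover have "sin (n * z) = sin (s * pi / 2)"
    unfolding nz using sin.plus_of_int[of "s * pi / 2" k] by simp
  then have "0 < s * sin (n * z)"
    using s by auto
  ultimately show thesis
    by (rule that)
qed

lemma dense_in_sine_set:
  assumes "F \<noteq> bot" and Nats: "eventually (\<lambda>x. x \<in> \<nat>) F"
    and large: "\<And>c. eventually (\<lambda>x. c < x) F" and s: "s = 1 \<or> s = -1"
  shows "dense_in (prod_topology (filter_topology F) meagre_topology) (sine_set s)"
  unfolding dense_in_iff
proof (intro conjI allI impI)
  let ?P = "prod_topology (filter_topology F) (meagre_topology :: real topology)"
  show "sine_set s \<subseteq> topspace ?P"
    by simp
  fix T assume T: "openin ?P T \<and> T \<noteq> {}"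
  then obtain x y where "(x, y) \<in> T"
    by auto
  then obtain A V where A: "openin (filter_topology F) A" "x \<in> A"
    and V: "openin meagre_topology V" "y \<in> V" and sub: "A \<times> V \<subseteq> T"
    using T unfolding openin_prod_topology_alt by blast
  obtain W M where W: "open W" "meagre M" "V = W - M"
    using V(1) unfolding openin_meagre_topology by blast
  obtain e where e: "0 < e" "\<And>z. dist z y < e \<Longrightarrow> z \<in> W"
    using V(2) W(1,3) unfolding open_dist by blast
  have "eventually (\<lambda>x. x \<in> A) F"
    using A unfolding openin_filter_topology by blast
  then have "eventually (\<lambda>n. n \<in> A \<and> n \<in> \<nat> \<and> 0 < n \<and> 3 * pi / e < n) F"
    using Nats large by (intro eventually_conj)
  from eventually_happens'[OF \<open>F \<noteq> bot\<close> this]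
  obtain n where n: "n \<in> A" "n \<in> \<nat>" "0 < n" "3 * pi / e < n"
    by auto
  have "3 * pi < n * e"
    using n(4) e(1) by (simp add: field_simps)
  then obtain z where z: "dist z y < e" "0 < s * sin (n * z)"
    using sine_sign_near[OF s n(3)] by blast
  let ?Z = "W \<inter> {z. 0 < s * sin (n * z)}"
  have "open ?Z"
    by (intro open_Int W(1) open_Collect_less continuous_intros)
  moreover have "?Z \<noteq> {}"
    using z e(2) by blast
  ultimately have "\<not> ?Z \<subseteq> M"
    using open_not_meagre meagre_subset[OF W(2)] by blast
  then obtain v where "v \<in> V" "0 < s * sin (n * v)"
    using W(3) by blast
  then have "(n, v) \<in> sine_set s \<inter> T"
    using n sub by (auto simp: sine_set_def)
  then show "sine_set s \<inter> T \<noteq> {}"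
    by blast
qed

theorem mainTheorem4:
  shows "\<exists>(X :: real topology) (Y :: real topology).
           topspace X \<noteq> {} \<and> topspace Y \<noteq> {} \<and>
           hereditarily Volterra_space X \<and>
           hereditarily Baire_space Y \<and>
           \<not> weakly_Volterra_space (prod_topology X Y)"
proof -
  obtain F where F: "F \<le> filtermap real sequentially" "ultra F"
    by (rule ultra_exists[of "filtermap real sequentially"]) (auto simp: filtermap_bot_iff)
  have ev: "eventually P F" if "eventually (\<lambda>n. P (real n)) sequentially" for P
    using F(1) that by (simp add: le_filter_def eventually_filtermap)
  have Nats: "eventually (\<lambda>x. x \<in> \<nat>) F"
    by (rule ev) simp
  have large: "eventually (\<lambda>x. c < x) F" for c
    by (rule ev) (use filterlim_real_sequentially in \<open>simp add: filterlim_at_top_dense\<close>)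
  then have free: "eventually (\<lambda>x. x \<noteq> c) F" for c
    by (rule eventually_mono) (use large in auto)
  let ?P = "prod_topology (filter_topology F) (meagre_topology :: real topology)"
  have "F \<noteq> bot"
    using F(2) by (simp add: ultra_def)
  have "gdelta_in ?P (sine_set s) \<and> dense_in ?P (sine_set s)" if "s = 1 \<or> s = -1" for s
    using gdelta_in_sine_set[OF Nats free] dense_in_sine_set[OF \<open>F \<noteq> bot\<close> Nats large that] by blast
  moreover have "sine_set 1 \<inter> sine_set (-1) = {}"
    by (auto simp: sine_set_def)
  ultimately have "\<not> weakly_Volterra_space ?P"
    unfolding weakly_Volterra_space_def by blast
  then show ?thesis
    using hereditarily_Volterra_ultra[OF F(2)] hereditarily_Baire_meagre_topology
    by (intro exI[of _ "filter_topology F"] exI[of _ meagre_topology]) simp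
qed

end
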